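(* Let $\mathbb{X}$ be a finite-dimensional real inner product space, $n\ge1$, $r,g_i:\mathbb{X}\to(-\infty,+\infty]$ proper closed convex, and $f_i:\mathbb{X}\to\mathbb{R}$ differentiable convex with $\|\nabla f_i(x)-\nabla f_i(y)\|\le L\|x-y\|$ for all $x,y$ and $i=1,\ldots,n$. Let $\alpha>0$, $\sigma\in[0,1)$, $\theta_k\in\mathbb{R}$ with $\theta_k+L\alpha/2\le\sigma$, and let $(x^{k+\frac12},x_i^k,z_i^k)$ be generated by the over-relaxed PPG (proximal-proximal-gradient) algorithm for $\min_{x\in\mathbb{X}}\ r(x)+\frac1n\sum_{i=1}^nf_i(x)+\frac1n\sum_{i=1}^ng_i(x)$, namely $$x^{k+\frac12}=\mathrm{Prox}_{\alpha r}\Big(\frac1n\sum_{i=1}^nz_i^k\Big),$$ $$x_i^{k+1}=\mathrm{Prox}_{\alpha g_i}\big(2x^{k+\frac12}-z_i^k-\alpha\nabla f_i(x^{k+\frac12})\big),\quad z_i^{k+1}=z_i^k+(1+\theta_k)(x_i^{k+1}-x^{k+\frac12}),\quad i=1,\ldots,n.$$ Put $\mathbf{x}^k=(x_1^k,\ldots,x_n^k)$, $\mathbf{z}^k=(z_1^k,\ldots,z_n^k)$, $x^{k+\frac12}\mathbf{1}=(x^{k+\frac12},\ldots,x^{k+\frac12})\in\mathbb{X}^n$, $\mathbf{y}^k=\mathbf{z}^k+\mathbf{x}^{k+1}-x^{k+\frac12}\mathbf{1}$, $\mathbf{v}^k=x^{k+\frac12}\mathbf{1}-\mathbf{x}^{k+1}$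 and $\epsilon_k=\frac{L}{4}\sum_{i=1}^n\|x_i^{k+1}-x^{k+\frac12}\|^2$. Then, with $T=\mathcal{S}_{\alpha,\nabla\overline{f}+\partial\overline{g},\partial\overline{r}}$ (defined in the context), $$(\mathbf{y}^k,\mathbf{v}^k)\in\mathrm{gph}\,T^{[\alpha\epsilon_k]},$$ $$\theta_k\|\mathbf{v}^k\|^2+\|\mathbf{v}^k+(\mathbf{y}^k-\mathbf{z}^k)\|^2+2\alpha\epsilon_k\le\sigma\|\mathbf{y}^k-\mathbf{z}^k\|^2,$$ $$\mathbf{z}^{k+1}=\mathbf{z}^k-(1+\theta_k)\mathbf{v}^k.$$
   Context: $\mathrm{Prox}_{\alpha h}(z)=\arg\min_xh(x)+\frac1{2\alpha}\|x-z\|^2$. $\mathbb{X}^n=\mathbb{X}\times\cdots\times\mathbb{X}$ carries the product inner product $\sum_i\langle x_i,y_i\rangle$. Let $V=\{\mathbf{x}=(x_1,\ldots,x_n)\in\mathbb{X}^n\mid x_1=\cdots=x_n\}$, $\mathbf{1}_V$ its indicator function ($0$ on $V$, $+\infty$ elsewhere), $\overline{f}(\mathbf{x})=\frac1n\sum_{i=1}^nf_i(x_i)$, $\overline{g}(\mathbf{x})=\frac1n\sum_{i=1}^ng_i(x_i)$, $\overline{r}(\mathbf{x})=\mathbf{1}_V(\mathbf{x})+\frac1n\sum_{i=1}^nr(x_i)$. The set-valued map $\mathcal{S}_{\alpha,\nabla\overline{f}+\partial\overline{g},\partial\overline{r}}:\mathbb{X}^n\rightrightarrows\mathbb{X}^n$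 has graph $$\{(\mathbf{x}_1+\alpha\mathbf{y}_2,\ \mathbf{x}_2-\mathbf{x}_1)\mid(\mathbf{x}_2,\mathbf{y}_2)\in\mathrm{gph}\,\partial\overline{r},\ (\mathbf{x}_1,\mathbf{y}_1)\in\mathrm{gph}(\nabla\overline{f}+\partial\overline{g}),\ \mathbf{x}_1+\alpha\mathbf{y}_1=\mathbf{x}_2-\alpha\mathbf{y}_2\};$$ it is maximal monotone. For $\epsilon\ge0$ the enlargement of an operator $T$ is $T^{[\epsilon]}(x)=\{v\mid\langle w-v,z-x\rangle\ge-\epsilon\ \forall z,\ \forall w\in T(z)\}$, and $\mathrm{gph}\,T^{[\epsilon]}=\{(x,v)\mid v\in T^{[\epsilon]}(x)\}$.
   Formalization: The operator T is taken with parameter nα in place of α, since with the unweighted product inner product and the factors 1/n the first claim fails for n ≥ 2 (e.g. n=2, r=g_i=0, f_i(x)=x on the real line); the zero space is excluded. *)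

theory Defs
  imports "HOL-Analysis.Analysis" "HOL-Library.Set_Algebras"
begin

section \<open>Extended-real-valued convex functions\<close>

definition ereal_epigraph :: "('a \<Rightarrow> ereal) \<Rightarrow> ('a \<times> real) set" where
  "ereal_epigraph h = {(x, t). h x \<le> ereal t}"

definition proper_closed_convex :: "('a::euclidean_space \<Rightarrow> ereal) \<Rightarrow> bool" where
  "proper_closed_convex h \<longleftrightarrow>
     (\<forall>x. h x \<noteq> -\<infinity>) \<and> (\<exists>x. h x \<noteq> \<infinity>) \<and>
     closed (ereal_epigraph h) \<and> convex (ereal_epigraph h)"

definition prox :: "real \<Rightarrow> ('a::real_inner \<Rightarrow> ereal) \<Rightarrow> 'a \<Rightarrow> 'a" where
  "prox \<alpha> h z = (ARG_MIN (\<lambda>x. h x + ereal (1 / (2 * \<alpha>) * (norm (x - z))\<^sup>2)) x. True)"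

definition subdifferential :: "('a::real_inner \<Rightarrow> ereal) \<Rightarrow> 'a \<Rightarrow> 'a set" where
  "subdifferential h x = {v. \<forall>y. h x + ereal (v \<bullet> (y - x)) \<le> h y}"

text \<open>Meaningful only at points of differentiability.\<close>

definition grad :: "('a::real_inner \<Rightarrow> real) \<Rightarrow> 'a \<Rightarrow> 'a" where
  "grad f x = (THE v. GDERIV f x :> v)"

section \<open>Set-valued operators\<close>

definition gph :: "('a \<Rightarrow> 'b set) \<Rightarrow> ('a \<times> 'b) set" where
  "gph T = {(x, v). v \<in> T x}"

definition enlargement :: "real \<Rightarrow> ('a::real_inner \<Rightarrow> 'a set) \<Rightarrow> 'a \<Rightarrow> 'a set" where
  "enlargement \<epsilon> T x = {v. \<forall>z. \<forall>w \<in> T z. (w - v) \<bullet> (z - x) \<ge> - \<epsilon>}"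

definition splitting_op ::
  "real \<Rightarrow> ('a::real_vector \<Rightarrow> 'a set) \<Rightarrow> ('a \<Rightarrow> 'a set) \<Rightarrow> 'a \<Rightarrow> 'a set" where
  "splitting_op \<alpha> A B p =
     {v. (p, v) \<in> {(x1 + \<alpha> *\<^sub>R y2, x2 - x1) | x1 y1 x2 y2.
        (x2, y2) \<in> gph B \<and> (x1, y1) \<in> gph A \<and> x1 + \<alpha> *\<^sub>R y1 = x2 - \<alpha> *\<^sub>R y2}}"

section \<open>The product space\<close>

text \<open>
  The \<open>n\<close>-fold product is \<open>'a ^ 'n\<close>, with \<open>n = CARD('n)\<close>. Its library inner product is the
  unweighted sum of the componentwise inner products, and \<open>grad\<close>, \<open>subdifferential\<close> and
  \<open>enlargement\<close> all refer to it. Because of the factor \<open>1/n\<close> in the averaged functions below,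
  the gradient of \<open>avg_fun f\<close> at \<open>x\<close> then has the components \<open>(1/n) grad (f i) (x $ i)\<close>, and
  likewise for the subdifferentials. A splitting step of size \<open>\<alpha>\<close> for the individual \<open>f i\<close>,
  \<open>g i\<close>, \<open>r\<close> is therefore a step of size \<open>n \<alpha>\<close> for the averaged functions. For this reason
  \<open>splitting_op\<close> is to be used with the parameter \<open>n \<alpha>\<close>; equivalently, one may keep \<open>\<alpha>\<close> and take
  gradients and subdifferentials with respect to the inner product scaled by \<open>1/n\<close>.
\<close>

definition diag :: "('a ^ 'n) set" where
  "diag = {x. \<forall>i j. x $ i = x $ j}"

definition indicat_ereal :: "'a set \<Rightarrow> 'a \<Rightarrow> ereal" where
  "indicat_ereal S x = (if x \<in> S then 0 else \<infinity>)"

definition avg_fun :: "('n::finite \<Rightarrow> 'a \<Rightarrow> real) \<Rightarrow> 'a ^ 'n \<Rightarrow> real" where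
  "avg_fun f x = 1 / real CARD('n) * (\<Sum>i\<in>UNIV. f i (x $ i))"

definition avg_ereal :: "('n::finite \<Rightarrow> 'a \<Rightarrow> ereal) \<Rightarrow> 'a ^ 'n \<Rightarrow> ereal" where
  "avg_ereal g x = ereal (1 / real CARD('n)) * (\<Sum>i\<in>UNIV. g i (x $ i))"

definition diag_avg :: "('a \<Rightarrow> ereal) \<Rightarrow> 'a ^ 'n::finite \<Rightarrow> ereal" where
  "diag_avg r x = indicat_ereal diag x + avg_ereal (\<lambda>_. r) x"

end

theory Submission
  imports Defs
begin

text \<open>
  Write \<open>b\<close> for the diagonal point \<open>vec (xh k)\<close>, \<open>a\<close> for \<open>x (Suc k)\<close> and \<open>c = n \<alpha>\<close>. The optimality
  conditions of the two proximal steps provide subgradients \<open>q\<close> of \<open>diag_avg r\<close> at \<open>b\<close> and \<open>t\<close> of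
  \<open>avg_ereal g\<close> at \<open>a\<close> such that \<open>c q = z k - b\<close> and
  \<open>a + c (grad (avg_fun f) b + t) = b - c q\<close>. Since \<open>y k = a + c q\<close> and \<open>v k = b - a\<close>, the pair
  \<open>(y k, v k)\<close> would lie in the graph of the splitting operator if the gradient were taken at \<open>a\<close>;
  the algorithm is inexact only in that it is taken at \<open>b\<close>.

  For any \<open>(p, w)\<close> in that graph the product \<open>(w - v k) \<bullet> (p - y k)\<close> splits into one monotonicity
  term for each of the two operators (\<open>splitting_op_enlargement\<close>). The subdifferentials contribute
  nonnegative amounts, so what remains is to bound
  \<open>(grad (f i) u - grad (f i) (b $ i)) \<bullet> (u - a $ i)\<close> from below for each \<open>i\<close> and all \<open>u\<close>.
  Cocoercivity of the gradient gives the bound \<open>- L / 4 |a $ i - b $ i|\<^sup>2\<close>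
  (\<open>gradient_three_point_bound\<close>), and the sum over \<open>i\<close> of these bounds is \<open>- \<epsilon> k\<close>.

  The other two claims are direct: \<open>y k - z k = - v k\<close>, so the middle term of the inequality
  vanishes and the rest is \<open>\<theta> k + L \<alpha> / 2 \<le> \<sigma>\<close> multiplied by \<open>|v k|\<^sup>2\<close>.

  The definition of \<open>prox\<close> by choice of a minimiser makes the attainment of the minimum part of the
  proof (\<open>prox_minimizes\<close>).
\<close>

section \<open>Smooth convex functions\<close>

lemma GDERIV_grad:
  fixes f :: "'a::euclidean_space \<Rightarrow> real"
  assumes "f differentiable (at u)"
  shows "GDERIV f u :> grad f u"
proof -
  obtain D where D: "(f has_derivative D) (at u)"
    using assms unfolding differentiable_def by blast
  then have "linear D"
    by (rule has_derivative_linear)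
  then have "D = (\<lambda>h. h \<bullet> adjoint D 1)"
    by (simp add: fun_eq_iff adjoint_works)
  with D have D': "GDERIV f u :> adjoint D 1"
    unfolding gderiv_def by simp
  moreover have "w = adjoint D 1" if "GDERIV f u :> w" for w
  proof -
    have "(\<lambda>h. h \<bullet> w) = (\<lambda>h. h \<bullet> adjoint D 1)"
      using that D' has_derivative_unique unfolding gderiv_def by blast
    then show ?thesis
      by (metis vector_eq_ldot)
  qed
  ultimately have "grad f u = adjoint D 1"
    unfolding grad_def by (rule the_equality)
  with D' show ?thesis
    by simp
qed

lemma DERIV_along_line:
  fixes f :: "'a::euclidean_space \<Rightarrow> real"
  assumes "\<And>u. f differentiable (at u)"
  shows "((\<lambda>t. f (u + t *\<^sub>R d)) has_real_derivative d \<bullet> grad f (u + t *\<^sub>R d)) (at t)"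
proof -
  have "((\<lambda>t. u + t *\<^sub>R d) has_derivative (\<lambda>s. s *\<^sub>R d)) (at t)"
    by (auto intro!: derivative_eq_intros)
  moreover have "(f has_derivative (\<lambda>h. h \<bullet> grad f (u + t *\<^sub>R d))) (at (u + t *\<^sub>R d))"
    using GDERIV_grad[OF assms] unfolding gderiv_def .
  ultimately have "((\<lambda>t. f (u + t *\<^sub>R d)) has_derivative (\<lambda>s. (s *\<^sub>R d) \<bullet> grad f (u + t *\<^sub>R d))) (at t)"
    by (rule has_derivative_compose)
  moreover have "(\<lambda>s. (s *\<^sub>R d) \<bullet> grad f (u + t *\<^sub>R d)) = (*) (d \<bullet> grad f (u + t *\<^sub>R d))"
    by (simp add: fun_eq_iff)
  ultimately show ?thesis
    by (simp add: has_field_derivative_def)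
qed

lemma convex_above_tangent:
  fixes f :: "'a::euclidean_space \<Rightarrow> real"
  assumes convex: "convex_on UNIV f" and diff: "\<And>u. f differentiable (at u)"
  shows "f u + grad f u \<bullet> (w - u) \<le> f w"
proof -
  let ?\<phi> = "\<lambda>t. f (u + t *\<^sub>R (w - u))"
  have "convex_on UNIV ?\<phi>"
  proof (rule convex_onI)
    fix t a b :: real
    assume "0 < t" "t < 1"
    moreover have "u + ((1 - t) *\<^sub>R a + t *\<^sub>R b) *\<^sub>R (w - u) =
        (1 - t) *\<^sub>R (u + a *\<^sub>R (w - u)) + t *\<^sub>R (u + b *\<^sub>R (w - u))"
      by (simp add: algebra_simps)
    ultimately show "?\<phi> ((1 - t) *\<^sub>R a + t *\<^sub>R b) \<le> (1 - t) * ?\<phi> a + t * ?\<phi> b"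
      using convex_onD[OF convex] by simp
  qed simp
  from convex_on_imp_above_tangent[OF this, of 0 1 "(w - u) \<bullet> grad f u"]
  show ?thesis
    using DERIV_along_line[OF diff, of u "w - u" 0] by (simp add: inner_commute)
qed

text \<open>Along the segment from \<open>u\<close> to \<open>u + d\<close>, the difference of the two sides has the derivative
  \<open>d \<bullet> (grad f (u + t d) - grad f u) - L t |d|\<^sup>2\<close>, which the Lipschitz bound makes nonpositive.\<close>

lemma descent_lemma:
  fixes f :: "'a::euclidean_space \<Rightarrow> real"
  assumes diff: "\<And>u. f differentiable (at u)"
    and lipschitz: "\<And>u w. norm (grad f u - grad f w) \<le> L * norm (u - w)"
  shows "f (u + d) \<le> f u + grad f u \<bullet> d + L / 2 * (norm d)\<^sup>2"
proof -
  define \<psi> where "\<psi> t = f (u + t *\<^sub>R d) - (grad f u \<bullet> d) * t - L / 2 * (norm d)\<^sup>2 * t\<^sup>2" for t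
  have "\<psi> 1 \<le> \<psi> 0"
  proof (rule DERIV_nonpos_imp_nonincreasing[where f = \<psi>])
    fix t :: real
    assume t: "0 \<le> t" "t \<le> 1"
    have "(\<psi> has_real_derivative
        d \<bullet> grad f (u + t *\<^sub>R d) - grad f u \<bullet> d - L * (norm d)\<^sup>2 * t) (at t)"
      unfolding \<psi>_def
      by (rule derivative_eq_intros DERIV_along_line[OF diff] refl | simp)+
    moreover have "d \<bullet> grad f (u + t *\<^sub>R d) - grad f u \<bullet> d \<le> L * (norm d)\<^sup>2 * t"
    proof -
      have "d \<bullet> grad f (u + t *\<^sub>R d) - grad f u \<bullet> d = d \<bullet> (grad f (u + t *\<^sub>R d) - grad f u)"
        by (simp add: inner_diff_right inner_commute)
      also have "\<dots> \<le> norm d * norm (grad f (u + t *\<^sub>R d) - grad f u)"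
        by (rule norm_cauchy_schwarz)
      also have "\<dots> \<le> norm d * (L * norm (t *\<^sub>R d))"
        using lipschitz[of "u + t *\<^sub>R d" u] by (intro mult_left_mono) auto
      finally show ?thesis
        using t by (simp add: power2_eq_square mult_ac)
    qed
    ultimately show "\<exists>y. (\<psi> has_real_derivative y) (at t) \<and> y \<le> 0"
      by (metis diff_le_0_iff_le)
  qed simp
  then show ?thesis
    by (simp add: \<psi>_def)
qed

text \<open>Both the tangent at \<open>u\<close> and the quadratic upper model at \<open>w\<close> are evaluated at
  \<open>w - (grad f w - grad f u) / L\<close>, where the gap between the two models is smallest.\<close>

lemma convex_above_tangent_plus_gradient_gap:
  fixes f :: "'a::euclidean_space \<Rightarrow> real"
  assumes convex: "convex_on UNIV f" and diff: "\<And>u. f differentiable (at u)"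
    and lipschitz: "\<And>u w. norm (grad f u - grad f w) \<le> L * norm (u - w)"
    and "L > 0"
  shows "f u + grad f u \<bullet> (w - u) + 1 / (2 * L) * (norm (grad f w - grad f u))\<^sup>2 \<le> f w"
proof -
  define e where "e = grad f w - grad f u"
  define d where "d = - (1 / L) *\<^sub>R e"
  have "f u + grad f u \<bullet> (w + d - u) \<le> f (w + d)"
    by (rule convex_above_tangent[OF convex diff])
  moreover have "f (w + d) \<le> f w + grad f w \<bullet> d + L / 2 * (norm d)\<^sup>2"
    by (rule descent_lemma[OF diff lipschitz])
  moreover have "grad f u \<bullet> (w + d - u) = grad f u \<bullet> (w - u) + grad f w \<bullet> d - e \<bullet> d"
    by (simp add: e_def algebra_simps)
  moreover have "e \<bullet> d = - (1 / L) * (norm e)\<^sup>2"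
    by (simp add: d_def power2_norm_eq_inner)
  moreover have "L / 2 * (norm d)\<^sup>2 = 1 / (2 * L) * (norm e)\<^sup>2"
    using \<open>L > 0\<close> by (simp add: d_def power_mult_distrib power2_eq_square field_simps)
  moreover have "1 / L * (norm e)\<^sup>2 = 2 * (1 / (2 * L) * (norm e)\<^sup>2)"
    by simp
  ultimately show ?thesis
    unfolding e_def by linarith
qed

text \<open>The only source of the error \<open>\<epsilon> k\<close>. Let \<open>e = grad f u - grad f b\<close>. For \<open>L > 0\<close>, cocoercivity of the
  gradient (Baillon-Haddad) gives \<open>e \<bullet> (u - b) \<ge> |e|\<^sup>2 / L\<close>, so the product in question is at least
  \<open>|e|\<^sup>2 / L - |e| |a - b|\<close>; the minimum of this quadratic in \<open>|e|\<close> is \<open>- L / 4 |a - b|\<^sup>2\<close>. The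
  constant is half of what convexity and the descent lemma give directly.\<close>

lemma gradient_three_point_bound:
  fixes f :: "'a::euclidean_space \<Rightarrow> real"
  assumes convex: "convex_on UNIV f" and diff: "\<And>u. f differentiable (at u)"
    and lipschitz: "\<And>u w. norm (grad f u - grad f w) \<le> L * norm (u - w)"
  shows "(grad f u - grad f b) \<bullet> (u - a) \<ge> - (L / 4) * (norm (a - b))\<^sup>2"
proof -
  define e where "e = grad f u - grad f b"
  have "L \<ge> 0"
  proof -
    obtain c :: 'a where "norm c = 1"
      using norm_Basis SOME_Basis by blast
    then show ?thesis
      using order_trans[OF norm_ge_zero lipschitz[of c 0]] by simp
  qed
  then consider "L = 0" | "L > 0"
    by linarith
  then show ?thesis
  proof cases
    case 1
    then show ?thesis
      using lipschitz[of u b] by simp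
  next
    case 2
    have "1 / L * (norm e)\<^sup>2 \<le> e \<bullet> (u - b)"
    proof -
      have "f u + grad f u \<bullet> (b - u) + 1 / (2 * L) * (norm e)\<^sup>2 \<le> f b"
        using convex_above_tangent_plus_gradient_gap[OF convex diff lipschitz 2, of u b]
        by (simp add: e_def norm_minus_commute)
      moreover have "f b + grad f b \<bullet> (u - b) + 1 / (2 * L) * (norm e)\<^sup>2 \<le> f u"
        using convex_above_tangent_plus_gradient_gap[OF convex diff lipschitz 2, of b u]
        by (simp add: e_def)
      moreover have "e \<bullet> (u - b) = - (grad f u \<bullet> (b - u)) - grad f b \<bullet> (u - b)"
        by (simp add: e_def algebra_simps)
      moreover have "1 / L * (norm e)\<^sup>2 = 2 * (1 / (2 * L) * (norm e)\<^sup>2)"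
        by simp
      ultimately show ?thesis
        by linarith
    qed
    moreover have "- (norm e * norm (b - a)) \<le> e \<bullet> (b - a)"
      using Cauchy_Schwarz_ineq2[of e "b - a"] by linarith
    moreover have "e \<bullet> (u - a) = e \<bullet> (u - b) + e \<bullet> (b - a)"
      by (simp add: algebra_simps)
    moreover have "0 \<le> 1 / L * (norm e)\<^sup>2 - norm e * norm (b - a) + L / 4 * (norm (b - a))\<^sup>2"
    proof -
      have "1 / L * (norm e)\<^sup>2 - norm e * norm (b - a) + L / 4 * (norm (b - a))\<^sup>2
          = 1 / L * (norm e - L / 2 * norm (b - a))\<^sup>2"
        using 2 by (simp add: power2_eq_square divide_simps) (simp add: algebra_simps)
      then show ?thesis
        using 2 by simp
    qed
    ultimately have "e \<bullet> (u - a) \<ge> - (L / 4) * (norm (b - a))\<^sup>2"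
      by linarith
    then show ?thesis
      by (simp only: e_def norm_minus_commute[of b a])
  qed
qed

section \<open>Proximal points\<close>

text \<open>A point strictly below the closed convex epigraph is separated from it, and the separating
  hyperplane is not vertical because it also separates the point from the one above it.\<close>

lemma proper_closed_convex_affine_minorant:
  fixes h :: "'a::euclidean_space \<Rightarrow> ereal"
  assumes "proper_closed_convex h"
  obtains a c where "\<And>x. ereal (c + a \<bullet> x) \<le> h x"
proof -
  obtain x0 where "h x0 \<noteq> \<infinity>" "h x0 \<noteq> -\<infinity>"
    using assms unfolding proper_closed_convex_def by blast
  then obtain t0 where t0: "h x0 = ereal t0"
    by (cases "h x0") auto
  let ?E = "ereal_epigraph h"
  have "(x0, t0 - 1) \<notin> ?E"
    by (simp add: ereal_epigraph_def t0)
  then obtain p b where "p \<bullet> (x0, t0 - 1) < b" "\<forall>q\<in>?E. b < p \<bullet> q"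
    using separating_hyperplane_closed_point[of ?E "(x0, t0 - 1)"] assms
    unfolding proper_closed_convex_def by metis
  moreover obtain p1 p2 where "p = (p1, p2)"
    by fastforce
  ultimately have below: "p1 \<bullet> x0 + p2 * (t0 - 1) < b"
    and above: "\<And>x t. h x \<le> ereal t \<Longrightarrow> b < p1 \<bullet> x + p2 * t"
    by (auto simp: ereal_epigraph_def)
  have "b < p1 \<bullet> x0 + p2 * t0"
    using above[of x0 t0] t0 by simp
  with below have "p2 > 0"
    by (simp add: algebra_simps)
  show thesis
  proof
    fix x
    have bound: "b / p2 + (- (1 / p2) *\<^sub>R p1) \<bullet> x \<le> t" if "h x \<le> ereal t" for t
      using above[OF that] \<open>p2 > 0\<close> by (simp add: field_simps)
    show "ereal (b / p2 + (- (1 / p2) *\<^sub>R p1) \<bullet> x) \<le> h x"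
      by (rule ereal_le_real) (use bound in simp)
  qed
qed

lemma bounded_quadratic_sublevel:
  fixes z :: "'a::real_inner"
  assumes "\<beta> > 0"
  shows "bounded {x. a \<bullet> x + \<beta> * (norm (x - z))\<^sup>2 \<le> c}"
proof (rule boundedI)
  fix x
  assume "x \<in> {x. a \<bullet> x + \<beta> * (norm (x - z))\<^sup>2 \<le> c}"
  then have x: "a \<bullet> x + \<beta> * (norm (x - z))\<^sup>2 \<le> c"
    by simp
  define K where "K = \<bar>c\<bar> + norm a * norm z"
  let ?u = "norm (x - z)"
  have "- (norm a * norm x) \<le> a \<bullet> x"
    using Cauchy_Schwarz_ineq2[of a x] by linarith
  moreover have "norm a * norm x \<le> norm a * (?u + norm z)"
    using norm_triangle_ineq[of "x - z" z] by (intro mult_left_mono) auto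
  ultimately have "\<beta> * ?u\<^sup>2 \<le> K + norm a * ?u"
    using x by (simp add: K_def algebra_simps)
  moreover have "K \<ge> 0"
    by (simp add: K_def)
  ultimately have "\<beta> * ?u\<^sup>2 \<le> (K + norm a) * ?u" if "?u \<ge> 1"
    using that mult_left_mono[of 1 ?u K] by (simp add: algebra_simps)
  then have "\<beta> * ?u \<le> K + norm a" if "?u \<ge> 1"
    using that mult_right_le_imp_le[of "\<beta> * ?u" ?u "K + norm a"]
    by (cases "x = z") (simp_all add: power2_eq_square mult.assoc)
  then have "?u \<le> (K + norm a) / \<beta>" if "?u \<ge> 1"
    using that \<open>\<beta> > 0\<close> by (simp add: pos_le_divide_eq mult.commute)
  moreover have "(K + norm a) / \<beta> \<ge> 0"
    using \<open>K \<ge> 0\<close> \<open>\<beta> > 0\<close> by simp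
  ultimately have "?u \<le> 1 + (K + norm a) / \<beta>"
    by linarith
  then show "norm x \<le> 1 + (K + norm a) / \<beta> + norm z"
    using norm_triangle_ineq[of "x - z" z] by simp
qed

text \<open>The regularised function is minimised over its epigraph rather than over the space: there the
  objective \<open>t + |x - z|\<^sup>2 / (2 \<alpha>)\<close> is continuous, and the affine minorant makes its sublevel
  sets bounded.\<close>

lemma prox_minimizes:
  fixes h :: "'a::euclidean_space \<Rightarrow> ereal"
  assumes h: "proper_closed_convex h" and "\<alpha> > 0"
  shows "h (prox \<alpha> h z) + ereal (1 / (2 * \<alpha>) * (norm (prox \<alpha> h z - z))\<^sup>2)
    \<le> h x + ereal (1 / (2 * \<alpha>) * (norm (x - z))\<^sup>2)"
proof -
  define \<beta> where "\<beta> = 1 / (2 * \<alpha>)"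
  have "\<beta> > 0"
    using \<open>\<alpha> > 0\<close> by (simp add: \<beta>_def)
  let ?obj = "\<lambda>x. h x + ereal (\<beta> * (norm (x - z))\<^sup>2)"
  define \<phi> where "\<phi> p = snd p + \<beta> * (norm (fst p - z))\<^sup>2" for p :: "'a \<times> real"
  obtain a c where minorant: "\<And>x. ereal (c + a \<bullet> x) \<le> h x"
    using proper_closed_convex_affine_minorant[OF h] by blast
  obtain x0 where "h x0 \<noteq> \<infinity>" "h x0 \<noteq> -\<infinity>"
    using h unfolding proper_closed_convex_def by blast
  then obtain t0 where t0: "h x0 = ereal t0"
    by (cases "h x0") auto
  define S where "S = ereal_epigraph h \<inter> {p. \<phi> p \<le> \<phi> (x0, t0)}"
  have cont: "continuous_on A \<phi>" for A
    unfolding \<phi>_def by (intro continuous_intros)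
  have "closed S"
    unfolding S_def using h
    by (intro closed_Int closed_Collect_le cont continuous_on_const)
      (simp add: proper_closed_convex_def)
  moreover have "bounded S"
  proof -
    let ?X = "{x. a \<bullet> x + \<beta> * (norm (x - z))\<^sup>2 \<le> \<phi> (x0, t0) - c}"
    obtain R where R: "\<And>x. x \<in> ?X \<Longrightarrow> norm x \<le> R"
      using bounded_quadratic_sublevel[OF \<open>\<beta> > 0\<close>, unfolded bounded_iff] by blast
    have "S \<subseteq> cball 0 R \<times> {c - norm a * R .. \<phi> (x0, t0)}"
    proof safe
      fix x t
      assume "(x, t) \<in> S"
      then have "h x \<le> ereal t" and le: "t + \<beta> * (norm (x - z))\<^sup>2 \<le> \<phi> (x0, t0)"
        by (auto simp: S_def ereal_epigraph_def \<phi>_def)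
      then have t: "c + a \<bullet> x \<le> t"
        using minorant[of x] by (metis ereal_less_eq(3) order_trans)
      with le have "norm x \<le> R"
        by (intro R) simp
      then show "x \<in> cball 0 R"
        by simp
      have "- (norm a * norm x) \<le> a \<bullet> x"
        using Cauchy_Schwarz_ineq2[of a x] by linarith
      moreover have "norm a * norm x \<le> norm a * R"
        using \<open>norm x \<le> R\<close> by (intro mult_left_mono) auto
      moreover have "0 \<le> \<beta> * (norm (x - z))\<^sup>2"
        using \<open>\<beta> > 0\<close> by simp
      ultimately show "t \<in> {c - norm a * R .. \<phi> (x0, t0)}"
        using t le by simp
    qed
    then show ?thesis
      by (rule bounded_subset[rotated]) (simp add: bounded_Times)
  qed
  ultimately have "compact S"
    by (simp add: compact_eq_bounded_closed)
  moreover have "(x0, t0) \<in> S"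
    by (simp add: S_def ereal_epigraph_def t0)
  ultimately obtain p where "p \<in> S" and p: "\<And>q. q \<in> S \<Longrightarrow> \<phi> p \<le> \<phi> q"
    using continuous_attains_inf[OF _ _ cont, of S] by blast
  have min: "\<phi> p \<le> \<phi> (x, t)" if "h x \<le> ereal t" for x t
  proof (cases "(x, t) \<in> S")
    case True
    then show ?thesis
      by (rule p)
  next
    case False
    then show ?thesis
      using that p[OF \<open>(x0, t0) \<in> S\<close>] by (simp add: S_def ereal_epigraph_def)
  qed
  have obj_p: "?obj (fst p) \<le> ereal (\<phi> p)"
  proof -
    have "h (fst p) \<le> ereal (snd p)"
      using \<open>p \<in> S\<close> by (auto simp: S_def ereal_epigraph_def)
    then have "?obj (fst p) \<le> ereal (snd p) + ereal (\<beta> * (norm (fst p - z))\<^sup>2)"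
      by (rule add_right_mono)
    then show ?thesis
      by (simp add: \<phi>_def)
  qed
  have "?obj (fst p) \<le> ?obj x" for x
  proof (cases "h x")
    case (real t)
    then show ?thesis
      using order_trans[OF obj_p, of "ereal (\<phi> (x, t))"] min[of x t] by (simp add: \<phi>_def)
  next
    case MInf
    then show ?thesis
      using h by (simp add: proper_closed_convex_def)
  qed simp
  then have "is_arg_min ?obj (\<lambda>_. True) (fst p)"
    by (simp add: is_arg_min_def not_less)
  then have "is_arg_min ?obj (\<lambda>_. True) (prox \<alpha> h z)"
    unfolding prox_def arg_min_def \<beta>_def by (rule someI)
  then show ?thesis
    by (simp add: is_arg_min_def not_less \<beta>_def)
qed

lemma prox_finite:
  fixes h :: "'a::euclidean_space \<Rightarrow> ereal"
  assumes h: "proper_closed_convex h" and "\<alpha> > 0"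
  shows "\<bar>h (prox \<alpha> h z)\<bar> \<noteq> \<infinity>"
proof -
  obtain x0 where "h x0 \<noteq> \<infinity>"
    using h unfolding proper_closed_convex_def by blast
  then have "h (prox \<alpha> h z) \<noteq> \<infinity>"
    using prox_minimizes[OF assms, of z x0] by auto
  then show ?thesis
    using h by (auto simp: proper_closed_convex_def)
qed

text \<open>Fermat's rule for the proximal problem. Comparing the minimiser \<open>p\<close> with the point
  \<open>p + t (y - p)\<close> and using convexity of \<open>h\<close> gives the subgradient inequality up to an error of
  order \<open>t\<close>, which vanishes as \<open>t\<close> tends to \<open>0\<close>.\<close>

lemma prox_subgradient:
  fixes h :: "'a::euclidean_space \<Rightarrow> ereal"
  assumes h: "proper_closed_convex h" and "\<alpha> > 0"
  shows "(1 / \<alpha>) *\<^sub>R (z - prox \<alpha> h z) \<in> subdifferential h (prox \<alpha> h z)"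
  unfolding subdifferential_def
proof (intro CollectI allI)
  fix y
  define p where "p = prox \<alpha> h z"
  obtain hp where hp: "h p = ereal hp"
    using prox_finite[OF assms, of z] unfolding p_def by (cases "h (prox \<alpha> h z)") auto
  have "h p + ereal ((1 / \<alpha>) *\<^sub>R (z - p) \<bullet> (y - p)) \<le> h y"
  proof (cases "h y")
    case (real hy)
    define d where "d = y - p"
    have bound: "(1 / \<alpha>) * ((z - p) \<bullet> d) \<le> hy - hp + t * (1 / (2 * \<alpha>) * (norm d)\<^sup>2)"
      if t: "0 < t" "t < 1" for t
    proof -
      have "(1 - t) *\<^sub>R (p, hp) + t *\<^sub>R (y, hy) \<in> ereal_epigraph h"
        using h t unfolding proper_closed_convex_def
        by (intro convexD) (auto simp: ereal_epigraph_def hp real)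
      moreover have "(1 - t) *\<^sub>R p + t *\<^sub>R y = p + t *\<^sub>R d"
        by (simp add: d_def algebra_simps)
      ultimately have "h (p + t *\<^sub>R d) \<le> ereal ((1 - t) * hp + t * hy)"
        by (simp add: ereal_epigraph_def)
      then have "h p + ereal (1 / (2 * \<alpha>) * (norm (p - z))\<^sup>2)
          \<le> ereal ((1 - t) * hp + t * hy) + ereal (1 / (2 * \<alpha>) * (norm (p + t *\<^sub>R d - z))\<^sup>2)"
        using prox_minimizes[OF assms, of z "p + t *\<^sub>R d"]
        unfolding p_def[symmetric] by (rule order_trans[OF _ add_right_mono, rotated])
      then have "hp + 1 / (2 * \<alpha>) * (norm (p - z))\<^sup>2
          \<le> (1 - t) * hp + t * hy + 1 / (2 * \<alpha>) * (norm (p + t *\<^sub>R d - z))\<^sup>2"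
        by (simp add: hp)
      moreover have "1 / (2 * \<alpha>) * (norm (p + t *\<^sub>R d - z))\<^sup>2 = 1 / (2 * \<alpha>) * (norm (p - z))\<^sup>2
          - t * ((1 / \<alpha>) * ((z - p) \<bullet> d)) + t * (t * (1 / (2 * \<alpha>) * (norm d)\<^sup>2))"
      proof -
        have "(norm (p + t *\<^sub>R d - z))\<^sup>2
            = (norm (p - z))\<^sup>2 - 2 * t * ((z - p) \<bullet> d) + t\<^sup>2 * (norm d)\<^sup>2"
          unfolding power2_norm_eq_inner
          by (simp add: inner_commute power2_eq_square algebra_simps)
        then show ?thesis
          using \<open>\<alpha> > 0\<close> by (simp only:) (simp add: field_simps power2_eq_square)
      qed
      ultimately have "hp \<le> (1 - t) * hp + t * hy - t * ((1 / \<alpha>) * ((z - p) \<bullet> d))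
          + t * (t * (1 / (2 * \<alpha>) * (norm d)\<^sup>2))"
        by simp
      then have "t * ((1 / \<alpha>) * ((z - p) \<bullet> d)) \<le> t * (hy - hp + t * (1 / (2 * \<alpha>) * (norm d)\<^sup>2))"
        unfolding distrib_left right_diff_distrib left_diff_distrib mult_1_left by simp
      then show ?thesis
        using t(1) by (rule mult_left_le_imp_le)
    qed
    have "((\<lambda>t. hy - hp + t * (1 / (2 * \<alpha>) * (norm d)\<^sup>2)) \<longlongrightarrow>
        hy - hp + 0 * (1 / (2 * \<alpha>) * (norm d)\<^sup>2)) (at_right 0)"
      by (intro tendsto_intros)
    moreover have "\<forall>\<^sub>F t in at_right 0.
        (1 / \<alpha>) * ((z - p) \<bullet> d) \<le> hy - hp + t * (1 / (2 * \<alpha>) * (norm d)\<^sup>2)"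
      using bound unfolding eventually_at_right_field by (intro exI[of _ 1]) auto
    ultimately have "(1 / \<alpha>) * ((z - p) \<bullet> d) \<le> hy - hp"
      using tendsto_lowerbound[OF _ _ trivial_limit_at_right_real] by fastforce
    then show ?thesis
      by (simp add: hp real d_def)
  next
    case MInf
    then show ?thesis
      using h by (simp add: proper_closed_convex_def)
  qed simp
  then show "h (prox \<alpha> h z) + ereal ((1 / \<alpha>) *\<^sub>R (z - prox \<alpha> h z) \<bullet> (y - prox \<alpha> h z)) \<le> h y"
    by (simp add: p_def)
qed

section \<open>Subdifferentials and averaged functions\<close>

lemma subdifferential_monotone:
  assumes v: "v \<in> subdifferential h x" and w: "w \<in> subdifferential h y"
    and finite: "\<bar>h y\<bar> \<noteq> \<infinity>"
  shows "(v - w) \<bullet> (x - y) \<ge> 0"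
proof -
  have xy: "h x + ereal (v \<bullet> (y - x)) \<le> h y" and yx: "h y + ereal (w \<bullet> (x - y)) \<le> h x"
    using v w unfolding subdifferential_def by auto
  have "\<bar>h x\<bar> \<noteq> \<infinity>"
    using xy yx finite by (cases "h x"; cases "h y") auto
  then have "v \<bullet> (y - x) + w \<bullet> (x - y) \<le> 0"
    using xy yx finite by (cases "h x"; cases "h y") auto
  then show ?thesis
    by (simp add: algebra_simps)
qed

lemma avg_ereal_finite:
  assumes "\<And>i. \<bar>g i (x $ i)\<bar> \<noteq> \<infinity>"
  shows "\<bar>avg_ereal g x\<bar> \<noteq> \<infinity>"
proof -
  have "g i (x $ i) = ereal (real_of_ereal (g i (x $ i)))" for i
    using assms[of i] by (simp add: ereal_real)
  then have "(\<Sum>i\<in>UNIV. g i (x $ i)) = ereal (\<Sum>i\<in>UNIV. real_of_ereal (g i (x $ i)))"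
    by (metis (no_types, lifting) sum.cong sum_ereal)
  then show ?thesis
    by (simp add: avg_ereal_def)
qed

lemma avg_ereal_subgradient_ineq:
  fixes g :: "'n::finite \<Rightarrow> 'a::real_inner \<Rightarrow> ereal"
  assumes "\<And>i. g i (x $ i) + ereal (c i) \<le> g i (y $ i)"
  shows "avg_ereal g x + ereal (1 / real CARD('n) * (\<Sum>i\<in>UNIV. c i)) \<le> avg_ereal g y"
proof -
  let ?n = "ereal (1 / real CARD('n))"
  have "(\<Sum>i\<in>UNIV. g i (x $ i)) + ereal (\<Sum>i\<in>UNIV. c i) = (\<Sum>i\<in>UNIV. g i (x $ i) + ereal (c i))"
    by (simp add: sum.distrib)
  also have "\<dots> \<le> (\<Sum>i\<in>UNIV. g i (y $ i))"
    using assms by (intro sum_mono)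
  finally have "?n * ((\<Sum>i\<in>UNIV. g i (x $ i)) + ereal (\<Sum>i\<in>UNIV. c i)) \<le> avg_ereal g y"
    unfolding avg_ereal_def by (intro ereal_mult_left_mono) auto
  moreover have "?n * ((\<Sum>i\<in>UNIV. g i (x $ i)) + ereal (\<Sum>i\<in>UNIV. c i))
      = avg_ereal g x + ereal (1 / real CARD('n) * (\<Sum>i\<in>UNIV. c i))"
    unfolding avg_ereal_def by (subst ereal_pos_distrib) auto
  ultimately show ?thesis
    by simp
qed

lemma subdifferential_avg_ereal:
  fixes g :: "'n::finite \<Rightarrow> 'a::real_inner \<Rightarrow> ereal"
  assumes "\<And>i. s $ i \<in> subdifferential (g i) (x $ i)"
  shows "(1 / real CARD('n)) *\<^sub>R s \<in> subdifferential (avg_ereal g) x"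
  unfolding subdifferential_def
proof (intro CollectI allI)
  fix y :: "'a ^ 'n"
  have "g i (x $ i) + ereal (s $ i \<bullet> (y $ i - x $ i)) \<le> g i (y $ i)" for i
    using assms[of i] by (simp add: subdifferential_def)
  from avg_ereal_subgradient_ineq[where g = g, OF this]
  show "avg_ereal g x + ereal ((1 / real CARD('n)) *\<^sub>R s \<bullet> (y - x)) \<le> avg_ereal g y"
    by (simp add: inner_vec_def sum_distrib_left)
qed

text \<open>On the diagonal only the mean of the components of a candidate subgradient \<open>q\<close> is seen; the
  rest of \<open>q\<close> is normal to the diagonal.\<close>

lemma subdifferential_diag_avg:
  fixes q :: "'a::real_inner ^ 'n::finite"
  assumes "(1 / real CARD('n)) *\<^sub>R (\<Sum>i\<in>UNIV. q $ i) \<in> subdifferential r u"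
  shows "(1 / real CARD('n)) *\<^sub>R q \<in> subdifferential (diag_avg r) (vec u)"
  unfolding subdifferential_def
proof (intro CollectI allI)
  fix y :: "'a ^ 'n"
  let ?m = "(1 / real CARD('n)) *\<^sub>R (\<Sum>i\<in>UNIV. q $ i)"
  show "diag_avg r (vec u :: 'a ^ 'n) + ereal ((1 / real CARD('n)) *\<^sub>R q \<bullet> (y - vec u)) \<le> diag_avg r y"
  proof (cases "y \<in> diag")
    case True
    then obtain w where w: "y = vec w"
      by (auto simp: diag_def vec_eq_iff)
    have "r u + ereal (?m \<bullet> (w - u)) \<le> r w"
      using assms by (simp add: subdifferential_def)
    then have "avg_ereal (\<lambda>_::'n. r) (vec u) + ereal (?m \<bullet> (w - u)) \<le> avg_ereal (\<lambda>_::'n. r) (vec w)"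
      using avg_ereal_subgradient_ineq[where g = "\<lambda>_::'n. r" and x = "vec u" and y = "vec w"
          and c = "\<lambda>_. ?m \<bullet> (w - u)"]
      by simp
    moreover have "(1 / real CARD('n)) *\<^sub>R q \<bullet> (vec w - vec u) = ?m \<bullet> (w - u)"
      by (simp add: inner_vec_def inner_sum_left sum_divide_distrib)
    ultimately show ?thesis
      using True by (simp add: w diag_avg_def indicat_ereal_def diag_def)
  next
    case False
    then have "diag_avg r y = \<infinity> + avg_ereal (\<lambda>_. r) y"
      by (simp add: diag_avg_def indicat_ereal_def)
    then show ?thesis
      by simp
  qed
qed

lemma grad_avg_fun:
  fixes f :: "'n::finite \<Rightarrow> 'a::euclidean_space \<Rightarrow> real"
  assumes diff: "\<And>i u. f i differentiable (at u)"
  shows "grad (avg_fun f) x = (1 / real CARD('n)) *\<^sub>R (\<chi> i. grad (f i) (x $ i))"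
proof -
  let ?G = "(1 / real CARD('n)) *\<^sub>R (\<chi> i. grad (f i) (x $ i))"
  have comp: "((\<lambda>x. f i (x $ i)) has_derivative (\<lambda>h. h $ i \<bullet> grad (f i) (x $ i))) (at x)" for i
    using has_derivative_compose[OF bounded_linear_imp_has_derivative[OF bounded_linear_vec_nth]
        GDERIV_grad[OF diff, unfolded gderiv_def]] .
  have "(avg_fun f has_derivative
      (\<lambda>h. 1 / real CARD('n) * (\<Sum>i\<in>UNIV. h $ i \<bullet> grad (f i) (x $ i)))) (at x)"
    unfolding avg_fun_def by (intro has_derivative_mult_right has_derivative_sum comp)
  moreover have "(\<lambda>h. 1 / real CARD('n) * (\<Sum>i\<in>UNIV. h $ i \<bullet> grad (f i) (x $ i))) = (\<lambda>h. h \<bullet> ?G)"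
    by (simp add: inner_vec_def sum_distrib_left fun_eq_iff)
  ultimately have G: "(avg_fun f has_derivative (\<lambda>h. h \<bullet> ?G)) (at x)"
    by simp
  then have "GDERIV (avg_fun f) x :> grad (avg_fun f) x"
    using GDERIV_grad differentiableI by blast
  with G have "(\<lambda>h. h \<bullet> grad (avg_fun f) x) = (\<lambda>h. h \<bullet> ?G)"
    using has_derivative_unique unfolding gderiv_def by blast
  then show ?thesis
    by (metis vector_eq_ldot)
qed

section \<open>The splitting operator\<close>

text \<open>Here \<open>(b, q)\<close> is monotonically related to the graph of \<open>B\<close>, and \<open>(a, s)\<close> to the graph of \<open>A\<close> up
  to the error \<open>\<delta>\<close>. Let \<open>(p, w)\<close> be the point of the graph of the splitting operator that is built
  from \<open>(x1, y1)\<close> and \<open>(x2, y2)\<close>. Subtracting the two resolvent equations expresses \<open>x2 - b\<close> by the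
  other three differences, and the cross terms cancel:
  \<open>(w - (b - a)) \<bullet> (p - (a + c q)) = c (y2 - q) \<bullet> (x2 - b) + c (y1 - s) \<bullet> (x1 - a)\<close>.\<close>

lemma splitting_op_enlargement:
  assumes "c \<ge> 0"
    and resolvent: "a + c *\<^sub>R s = b - c *\<^sub>R q"
    and A: "\<And>x1 y1. y1 \<in> A x1 \<Longrightarrow> (y1 - s) \<bullet> (x1 - a) \<ge> - \<delta>"
    and B: "\<And>x2 y2. y2 \<in> B x2 \<Longrightarrow> (y2 - q) \<bullet> (x2 - b) \<ge> 0"
  shows "b - a \<in> enlargement (c * \<delta>) (splitting_op c A B) (a + c *\<^sub>R q)"
  unfolding enlargement_def
proof (intro CollectI allI ballI)
  fix p w
  assume "w \<in> splitting_op c A B p"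
  then obtain x1 y1 x2 y2 where p: "p = x1 + c *\<^sub>R y2" and w: "w = x2 - x1"
    and y2: "y2 \<in> B x2" and y1: "y1 \<in> A x1" and xy: "x1 + c *\<^sub>R y1 = x2 - c *\<^sub>R y2"
    by (auto simp: splitting_op_def gph_def)
  define d1 e1 d2 e2 where "d1 = x1 - a" and "e1 = y1 - s" and "d2 = x2 - b" and "e2 = y2 - q"
  have "d2 = d1 + c *\<^sub>R e1 + c *\<^sub>R e2"
    using xy resolvent by (simp add: d1_def e1_def d2_def e2_def algebra_simps)
  moreover have "w - (b - a) = d2 - d1" "p - (a + c *\<^sub>R q) = d1 + c *\<^sub>R e2"
    by (simp_all add: p w d1_def d2_def e2_def algebra_simps)
  ultimately have "(w - (b - a)) \<bullet> (p - (a + c *\<^sub>R q)) = c * (e2 \<bullet> d2) + c * (e1 \<bullet> d1)"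
    by (simp add: inner_commute algebra_simps)
  moreover have "c * (e2 \<bullet> d2) \<ge> 0"
    using B[OF y2] \<open>c \<ge> 0\<close> by (simp add: d2_def e2_def)
  moreover have "c * (e1 \<bullet> d1) \<ge> c * (- \<delta>)"
    using A[OF y1] \<open>c \<ge> 0\<close> unfolding d1_def e1_def by (rule mult_left_mono)
  ultimately show "(w - (b - a)) \<bullet> (p - (a + c *\<^sub>R q)) \<ge> - (c * \<delta>)"
    by simp
qed

theorem proposition3:
  fixes r :: "'a::euclidean_space \<Rightarrow> ereal"
    and f :: "'n::finite \<Rightarrow> 'a \<Rightarrow> real"
    and g :: "'n \<Rightarrow> 'a \<Rightarrow> ereal"
    and L \<alpha> \<sigma> :: real
    and \<theta> \<epsilon> :: "nat \<Rightarrow> real"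
    and xh :: "nat \<Rightarrow> 'a"
    and x z y v :: "nat \<Rightarrow> 'a ^ 'n"
  assumes r: "proper_closed_convex r"
    and g: "\<And>i. proper_closed_convex (g i)"
    and f_convex: "\<And>i. convex_on UNIV (f i)"
    and f_diff: "\<And>i u. f i differentiable (at u)"
    and f_lipschitz: "\<And>i u w. norm (grad (f i) u - grad (f i) w) \<le> L * norm (u - w)"
    and \<alpha>: "\<alpha> > 0"
    and \<sigma>: "0 \<le> \<sigma>" "\<sigma> < 1"
    and \<theta>: "\<And>k. \<theta> k + L * \<alpha> / 2 \<le> \<sigma>"
    and xh_step: "\<And>k. xh k = prox \<alpha> r ((1 / real CARD('n)) *\<^sub>R (\<Sum>i\<in>UNIV. z k $ i))"
    and x_step: "\<And>k i. x (Suc k) $ i =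
      prox \<alpha> (g i) (2 *\<^sub>R xh k - z k $ i - \<alpha> *\<^sub>R grad (f i) (xh k))"
    and z_step: "\<And>k i. z (Suc k) $ i = z k $ i + (1 + \<theta> k) *\<^sub>R (x (Suc k) $ i - xh k)"
    and y: "\<And>k. y k = z k + x (Suc k) - vec (xh k)"
    and v: "\<And>k. v k = vec (xh k) - x (Suc k)"
    and \<epsilon>: "\<And>k. \<epsilon> k = L / 4 * (\<Sum>i\<in>UNIV. (norm (x (Suc k) $ i - xh k))\<^sup>2)"
  shows "\<forall>k.
      (y k, v k) \<in> gph (enlargement (\<alpha> * \<epsilon> k)
        (splitting_op (real CARD('n) * \<alpha>)
          (\<lambda>u. grad (avg_fun f) u +o subdifferential (avg_ereal g) u)
          (subdifferential (diag_avg r)))) \<and>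
      \<theta> k * (norm (v k))\<^sup>2 + (norm (v k + (y k - z k)))\<^sup>2 + 2 * \<alpha> * \<epsilon> k
        \<le> \<sigma> * (norm (y k - z k))\<^sup>2 \<and>
      z (Suc k) = z k - (1 + \<theta> k) *\<^sub>R v k"
proof (intro allI conjI)
  fix k
  let ?n = "real CARD('n)"
  have v_comp: "v k $ i = xh k - x (Suc k) $ i" for i
    by (simp add: v)
  have y_minus_z: "y k - z k = - v k"
    by (simp add: y v)
  have norm_v: "(norm (v k))\<^sup>2 = (\<Sum>i\<in>UNIV. (norm (x (Suc k) $ i - xh k))\<^sup>2)"
    by (simp add: power2_norm_eq_inner inner_vec_def v_comp) (simp add: inner_commute algebra_simps)

  show "z (Suc k) = z k - (1 + \<theta> k) *\<^sub>R v k"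
    by (simp add: vec_eq_iff z_step v_comp algebra_simps)

  show "\<theta> k * (norm (v k))\<^sup>2 + (norm (v k + (y k - z k)))\<^sup>2 + 2 * \<alpha> * \<epsilon> k
      \<le> \<sigma> * (norm (y k - z k))\<^sup>2"
  proof -
    have "(\<theta> k + L * \<alpha> / 2) * (norm (v k))\<^sup>2 \<le> \<sigma> * (norm (v k))\<^sup>2"
      using \<theta> by (intro mult_right_mono) auto
    moreover have "(\<theta> k + L * \<alpha> / 2) * (norm (v k))\<^sup>2 = \<theta> k * (norm (v k))\<^sup>2 + 2 * \<alpha> * \<epsilon> k"
      unfolding \<epsilon> norm_v[symmetric] by (simp add: algebra_simps)
    ultimately show ?thesis
      by (simp add: y_minus_z)
  qed

  define a b where "a = x (Suc k)" and "b = (vec (xh k) :: 'a ^ 'n)"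
  define c where "c = ?n * \<alpha>"
  \<comment> \<open>\<open>t\<close> consists of the residuals of the steps in the \<open>g i\<close>. In \<open>q\<close>, only the mean of the components
    of \<open>z k - b\<close> is a proximal residual; that is enough for the diagonal. The factor \<open>1 / n\<close> turns
    subgradients of the summands into subgradients of the averages.\<close>
  define q where "q = (1 / ?n) *\<^sub>R ((1 / \<alpha>) *\<^sub>R (z k - b))"
  define t where "t = (1 / ?n) *\<^sub>R (\<chi> i. (1 / \<alpha>) *\<^sub>R
      (2 *\<^sub>R xh k - z k $ i - \<alpha> *\<^sub>R grad (f i) (xh k) - a $ i))"
  \<comment> \<open>The gradient enters at \<open>b\<close>, so \<open>s\<close> is in general no element of the operator at \<open>a\<close>.\<close>
  define s where "s = grad (avg_fun f) b + t"
  have "c > 0"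
    using \<alpha> by (simp add: c_def)
  have cq: "c *\<^sub>R q = z k - b"
    using \<alpha> by (simp add: c_def q_def)
  have q: "q \<in> subdifferential (diag_avg r) b"
  proof -
    have "(1 / ?n) *\<^sub>R (\<Sum>i\<in>UNIV. ((1 / \<alpha>) *\<^sub>R (z k - b)) $ i)
        = (1 / \<alpha>) *\<^sub>R ((1 / ?n) *\<^sub>R (\<Sum>i\<in>UNIV. z k $ i) - xh k)"
      by (simp add: b_def sum_subtractf scaleR_right_diff_distrib sum_constant_scaleR
          flip: scaleR_sum_right)
    also have "\<dots> \<in> subdifferential r (xh k)"
      unfolding xh_step by (rule prox_subgradient[OF r \<alpha>])
    finally show ?thesis
      unfolding q_def b_def by (rule subdifferential_diag_avg)
  qed
  have t: "t \<in> subdifferential (avg_ereal g) a"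
    unfolding t_def
    by (intro subdifferential_avg_ereal) (simp add: a_def x_step prox_subgradient[OF g \<alpha>])
  have a_finite: "\<bar>avg_ereal g a\<bar> \<noteq> \<infinity>"
    by (intro avg_ereal_finite) (simp only: a_def x_step prox_finite[OF g \<alpha>] not_False_eq_True)
  have b_finite: "\<bar>diag_avg r b\<bar> \<noteq> \<infinity>"
  proof -
    have "\<bar>r (xh k)\<bar> \<noteq> \<infinity>"
      unfolding xh_step by (rule prox_finite[OF r \<alpha>])
    then have "\<bar>avg_ereal (\<lambda>_::'n. r) b\<bar> \<noteq> \<infinity>"
      by (intro avg_ereal_finite) (simp add: b_def)
    then show ?thesis
      by (simp add: diag_avg_def indicat_ereal_def diag_def b_def)
  qed
  have resolvent: "a + c *\<^sub>R s = b - c *\<^sub>R q"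
    unfolding cq unfolding s_def t_def grad_avg_fun[OF f_diff] c_def
    using \<alpha> by (simp add: vec_eq_iff b_def algebra_simps scaleR_2)

  have gradient_part: "(grad (avg_fun f) u - grad (avg_fun f) b) \<bullet> (u - a) \<ge> - (\<epsilon> k / ?n)" for u
  proof -
    have "- (L / 4) * (\<Sum>i\<in>UNIV. (norm (a $ i - xh k))\<^sup>2)
        \<le> (\<Sum>i\<in>UNIV. (grad (f i) (u $ i) - grad (f i) (xh k)) \<bullet> (u $ i - a $ i))"
      unfolding sum_distrib_left
      by (intro sum_mono gradient_three_point_bound f_convex f_diff f_lipschitz)
    then have "1 / ?n * (- \<epsilon> k)
        \<le> 1 / ?n * (\<Sum>i\<in>UNIV. (grad (f i) (u $ i) - grad (f i) (xh k)) \<bullet> (u $ i - a $ i))"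
      by (intro mult_left_mono) (simp_all add: \<epsilon> a_def)
    also have "\<dots> = (grad (avg_fun f) u - grad (avg_fun f) b) \<bullet> (u - a)"
      unfolding grad_avg_fun[OF f_diff]
      by (simp add: b_def inner_vec_def sum_distrib_left flip: scaleR_right_diff_distrib)
    finally show ?thesis
      by simp
  qed
  have "b - a \<in> enlargement (c * (\<epsilon> k / ?n))
      (splitting_op c (\<lambda>u. grad (avg_fun f) u +o subdifferential (avg_ereal g) u)
        (subdifferential (diag_avg r))) (a + c *\<^sub>R q)"
  proof (rule splitting_op_enlargement)
    show "c \<ge> 0"
      using \<open>c > 0\<close> by simp
    show "a + c *\<^sub>R s = b - c *\<^sub>R q"
      by (rule resolvent)
    show "(y2 - q) \<bullet> (x2 - b) \<ge> 0" if "y2 \<in> subdifferential (diag_avg r) x2" for x2 y2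
      using that q b_finite by (rule subdifferential_monotone)
    fix x1 y1
    assume "y1 \<in> grad (avg_fun f) x1 +o subdifferential (avg_ereal g) x1"
    then obtain t1 where t1: "t1 \<in> subdifferential (avg_ereal g) x1"
      and y1: "y1 = grad (avg_fun f) x1 + t1"
      by (auto simp: elt_set_plus_def)
    have "(t1 - t) \<bullet> (x1 - a) \<ge> 0"
      using t1 t a_finite by (rule subdifferential_monotone)
    moreover have "(y1 - s) \<bullet> (x1 - a)
        = (grad (avg_fun f) x1 - grad (avg_fun f) b) \<bullet> (x1 - a) + (t1 - t) \<bullet> (x1 - a)"
      by (simp add: y1 s_def algebra_simps)
    ultimately show "(y1 - s) \<bullet> (x1 - a) \<ge> - (\<epsilon> k / ?n)"
      using gradient_part[of x1] by linarith
  qed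
  moreover have "c * (\<epsilon> k / ?n) = \<alpha> * \<epsilon> k" "a + c *\<^sub>R q = y k" "b - a = v k"
    unfolding cq by (simp_all add: c_def y v a_def b_def)
  ultimately show "(y k, v k) \<in> gph (enlargement (\<alpha> * \<epsilon> k)
      (splitting_op (?n * \<alpha>)
        (\<lambda>u. grad (avg_fun f) u +o subdifferential (avg_ereal g) u)
        (subdifferential (diag_avg r))))"
    by (simp add: gph_def c_def)
qed

end
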